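(* Let $R$ be a commutative ring and let $M$ be a semiprime $R$-module. Then the following statements are equivalent: (a) $\chi(AG(M)^* )$ is finite; (b) $cl(AG(M)^* )$ is finite; (c) $AG(M)^*$ does not have an infinite clique.
   Context: $R$ is a commutative ring with nonzero identity and $M$ is a unital $R$-module. For $N\le M$ (submodule), $(N:M)=\{r\in R\mid rM\subseteq N\}$, and $Ann(M)=((0):M)$. A proper submodule $N$ of $M$ is semiprime if for every ideal $I$ of $R$ and every submodule $K$ of $M$, $I^2K\subseteq N$ implies $IK\subseteq N$; $M$ is a semiprime module if $(0)$ is a semiprime submodule of $M$. The product of $N,K\le M$ is $NK=(N:M)(K:M)M$. $AG(M)^*$ is the undirected graph whose vertices are the proper submodules $N$ of $M$ with $(N:M)\neq Ann(M)$ for which there exists a proper submodule $K$ of $M$ (possibly $K=N$) with $(K:M)\neq Ann(M)$ and $NK=(0)$; two distinct vertices $N,K$ are adjacent if and only if $NK=(0)$. $\chi(G)$ is the chromatic number of a graph $G$ and $cl(G)$ its clique number (the number of vertices in a largest clique, a clique being a maximal complete subgraph). *)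

theory Defs
  imports "HOL-Algebra.Module" "HOL-Algebra.Ideal_Product" "HOL-Library.Extended_Nat"
begin

section \<open>Semiprime modules\<close>

definition colon :: "('a, 'c) ring_scheme \<Rightarrow> ('a, 'b, 'd) module_scheme \<Rightarrow> 'b set \<Rightarrow> 'a set"
  where "colon R M N = {r \<in> carrier R. \<forall>x \<in> carrier M. r \<odot>\<^bsub>M\<^esub> x \<in> N}"

definition Ann :: "('a, 'c) ring_scheme \<Rightarrow> ('a, 'b, 'd) module_scheme \<Rightarrow> 'a set"
  where "Ann R M = colon R M {\<zero>\<^bsub>M\<^esub>}"

text \<open>The submodule \<open>IK\<close> of finite sums of products, in the style of \<^const>\<open>ideal_prod\<close>;
  \<open>I\<close> is supposed to be an ideal and \<open>K\<close> a submodule, so the empty sum is covered by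
  \<open>\<zero> \<odot> x\<close>.\<close>

inductive_set ideal_smult :: "('a, 'b, 'd) module_scheme \<Rightarrow> 'a set \<Rightarrow> 'b set \<Rightarrow> 'b set"
  for M and I and K where
    smult: "\<lbrakk> i \<in> I; x \<in> K \<rbrakk> \<Longrightarrow> i \<odot>\<^bsub>M\<^esub> x \<in> ideal_smult M I K"
  | sum: "\<lbrakk> u \<in> ideal_smult M I K; v \<in> ideal_smult M I K \<rbrakk> \<Longrightarrow> u \<oplus>\<^bsub>M\<^esub> v \<in> ideal_smult M I K"

definition proper_submodule :: "'b set \<Rightarrow> ('a, 'c) ring_scheme \<Rightarrow> ('a, 'b, 'd) module_scheme \<Rightarrow> bool"
  where "proper_submodule N R M \<longleftrightarrow> submodule N R M \<and> N \<noteq> carrier M"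

definition semiprime_submodule :: "'b set \<Rightarrow> ('a, 'c) ring_scheme \<Rightarrow> ('a, 'b, 'd) module_scheme \<Rightarrow> bool"
  where "semiprime_submodule N R M \<longleftrightarrow> proper_submodule N R M \<and>
    (\<forall>I K. ideal I R \<longrightarrow> submodule K R M \<longrightarrow>
       ideal_smult M (I \<cdot>\<^bsub>R\<^esub> I) K \<subseteq> N \<longrightarrow> ideal_smult M I K \<subseteq> N)"

definition semiprime_module :: "('a, 'c) ring_scheme \<Rightarrow> ('a, 'b, 'd) module_scheme \<Rightarrow> bool"
  where "semiprime_module R M \<longleftrightarrow> semiprime_submodule {\<zero>\<^bsub>M\<^esub>} R M"

definition submodule_prod ::
    "('a, 'c) ring_scheme \<Rightarrow> ('a, 'b, 'd) module_scheme \<Rightarrow> 'b set \<Rightarrow> 'b set \<Rightarrow> 'b set"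
  where "submodule_prod R M N K = ideal_smult M (colon R M N \<cdot>\<^bsub>R\<^esub> colon R M K) (carrier M)"


section \<open>Graphs, possibly infinite\<close>

record 'v ugraph =
  verts :: "'v set"
  adj :: "'v \<Rightarrow> 'v \<Rightarrow> bool"

definition complete_in :: "'v ugraph \<Rightarrow> 'v set \<Rightarrow> bool"
  where "complete_in G C \<longleftrightarrow> C \<subseteq> verts G \<and> (\<forall>x \<in> C. \<forall>y \<in> C. x \<noteq> y \<longrightarrow> adj G x y)"

definition is_clique :: "'v ugraph \<Rightarrow> 'v set \<Rightarrow> bool"
  where "is_clique G C \<longleftrightarrow> complete_in G C \<and> (\<forall>D. complete_in G D \<longrightarrow> C \<subseteq> D \<longrightarrow> D = C)"

text \<open>A supremum, hence \<open>\<infinity>\<close> if there are cliques of unbounded finite size or an infinite one.\<close>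

definition clique_number :: "'v ugraph \<Rightarrow> enat"
  where "clique_number G =
    Sup ((\<lambda>C. if finite C then enat (card C) else \<infinity>) ` {C. is_clique G C})"

definition proper_coloring :: "'v ugraph \<Rightarrow> nat \<Rightarrow> ('v \<Rightarrow> nat) \<Rightarrow> bool"
  where "proper_coloring G k f \<longleftrightarrow> f ` verts G \<subseteq> {..<k} \<and>
    (\<forall>x \<in> verts G. \<forall>y \<in> verts G. adj G x y \<longrightarrow> f x \<noteq> f y)"

text \<open>The infimum of the empty set is \<open>\<infinity>\<close>: no finite number of colours suffices.\<close>

definition chromatic_number :: "'v ugraph \<Rightarrow> enat"
  where "chromatic_number G = Inf (enat ` {k. \<exists>f. proper_coloring G k f})"


section \<open>The annihilating-submodule graph \<open>AG(M)\<^sup>*\<close>\<close>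

definition AG_star :: "('a, 'c) ring_scheme \<Rightarrow> ('a, 'b, 'd) module_scheme \<Rightarrow> 'b set ugraph"
  where "AG_star R M =
    \<lparr> verts = {N. proper_submodule N R M \<and> colon R M N \<noteq> Ann R M \<and>
                (\<exists>K. proper_submodule K R M \<and> colon R M K \<noteq> Ann R M \<and>
                     submodule_prod R M N K = {\<zero>\<^bsub>M\<^esub>})},
      adj = (\<lambda>N K. N \<noteq> K \<and> submodule_prod R M N K = {\<zero>\<^bsub>M\<^esub>}) \<rparr>"

lemma AG_star_adj_irrefl: "\<not> adj (AG_star R M) N N"
  by (simp add: AG_star_def)

lemma AG_star_adj_sym:
  assumes "cring R" and "adj (AG_star R M) N K"
  shows "adj (AG_star R M) K N"
proof -
  interpret cring R by fact
  have sub: "A \<cdot>\<^bsub>R\<^esub> B \<subseteq> B \<cdot>\<^bsub>R\<^esub> A" if "A \<subseteq> carrier R" "B \<subseteq> carrier R" for A B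
  proof
    fix x assume "x \<in> A \<cdot>\<^bsub>R\<^esub> B"
    then show "x \<in> B \<cdot>\<^bsub>R\<^esub> A"
    proof (induction rule: ideal_prod.induct)
      case (prod i j)
      then have "i \<otimes>\<^bsub>R\<^esub> j = j \<otimes>\<^bsub>R\<^esub> i"
        using that m_comm by blast
      with prod show ?case by (simp add: ideal_prod.prod)
    qed (rule ideal_prod.sum)
  qed
  have "colon R M L \<subseteq> carrier R" for L
    by (auto simp: colon_def)
  then have "colon R M N \<cdot>\<^bsub>R\<^esub> colon R M K = colon R M K \<cdot>\<^bsub>R\<^esub> colon R M N"
    using sub by (meson subset_antisym)
  then show ?thesis
    using assms(2) by (auto simp add: AG_star_def submodule_prod_def)
qed

end

theory Submission
  imports Defs
begin

text \<open>Write \<open>A = Ann(M)\<close>, a radical ideal because \<open>M\<close> is semiprime. Elements \<open>r, s \<notin> A\<close> with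
  \<open>rs \<in> A\<close> give adjacent vertices \<open>rM\<close> and \<open>sM\<close>, so if \<open>AG(M)\<^sup>*\<close> has no infinite clique, then
  \<open>R/A\<close> has no infinite set of pairwise orthogonal nonzero elements. Call \<open>u \<notin> A\<close> uniform if
  \<open>(A : u)\<close> is prime. Splitting a non-uniform element into two orthogonal multiples and iterating
  would produce an infinite orthogonal set, so every \<open>x \<notin> A\<close> has a uniform multiple. A maximal
  orthogonal set \<open>U\<close> of uniform elements is finite, and colouring a vertex \<open>N\<close> by some \<open>u \<in> U\<close>
  with \<open>(N : M) u \<not>\<subseteq> A\<close> is proper.\<close>

section \<open>Cliques and colourings\<close>

text \<open>Zorn's lemma: any two points in the union of a chain of complete sets already lie in a
  common member, so the union is complete. Cliques are maximal by definition, while the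
  constructions below yield merely complete sets; this bridges the gap.\<close>

lemma complete_in_extends_to_clique:
  assumes "complete_in G D"
  obtains C where "is_clique G C" "D \<subseteq> C"
proof -
  let ?S = "{E. complete_in G E \<and> D \<subseteq> E}"
  have "\<exists>C\<in>?S. \<forall>X\<in>?S. C \<subseteq> X \<longrightarrow> X = C"
  proof (rule subset_Zorn_nonempty)
    show "?S \<noteq> {}" using assms by blast
  next
    fix \<C> assume ne: "\<C> \<noteq> {}" and ch: "subset.chain ?S \<C>"
    have sub: "\<C> \<subseteq> ?S" and lin: "\<And>X Y. X \<in> \<C> \<Longrightarrow> Y \<in> \<C> \<Longrightarrow> X \<subseteq> Y \<or> Y \<subseteq> X"
      using ch unfolding subset_chain_def by blast+
    have "adj G x y" if "x \<in> X" "X \<in> \<C>" "y \<in> Y" "Y \<in> \<C>" "x \<noteq> y" for x y X Y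
    proof -
      obtain Z where "Z \<in> \<C>" "x \<in> Z" "y \<in> Z"
        using lin[of X Y] \<open>x \<in> X\<close> \<open>X \<in> \<C>\<close> \<open>y \<in> Y\<close> \<open>Y \<in> \<C>\<close> by blast
      then show ?thesis
        using sub \<open>x \<noteq> y\<close> unfolding complete_in_def by blast
    qed
    moreover have "\<Union>\<C> \<subseteq> verts G"
      using sub unfolding complete_in_def by blast
    ultimately have "complete_in G (\<Union>\<C>)"
      unfolding complete_in_def by (meson UnionE)
    moreover have "D \<subseteq> \<Union>\<C>"
      using ne sub by blast
    ultimately show "\<Union>\<C> \<in> ?S" by simp
  qed
  then obtain C where C: "C \<in> ?S" and max: "\<forall>X\<in>?S. C \<subseteq> X \<longrightarrow> X = C"
    by (rule bexE)
  have "X = C" if "complete_in G X" "C \<subseteq> X" for X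
    using max[rule_format, of X] that C by auto
  then have "is_clique G C"
    using C unfolding is_clique_def by simp
  then show thesis using that C by simp
qed

section \<open>Finiteness of the chromatic number and of the clique number\<close>

lemma chromatic_number_finite_iff:
  "chromatic_number G < \<infinity> \<longleftrightarrow> (\<exists>k f. proper_coloring G k f)"
  unfolding chromatic_number_def Inf_less_iff by auto

lemma proper_coloring_clique_card:
  assumes "proper_coloring G k f" "is_clique G C"
  shows "finite C" "card C \<le> k"
proof -
  have C: "C \<subseteq> verts G" "\<And>x y. x \<in> C \<Longrightarrow> y \<in> C \<Longrightarrow> x \<noteq> y \<Longrightarrow> adj G x y"
    using assms(2) unfolding is_clique_def complete_in_def by auto
  have sub: "f ` C \<subseteq> {..<k}"
    using assms(1) C(1) unfolding proper_coloring_def by blast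
  have inj: "inj_on f C"
    using assms(1) C unfolding proper_coloring_def by (meson inj_onI subsetD)
  show "finite C"
    using inj_on_finite[OF inj sub] by simp
  show "card C \<le> k"
    using card_inj_on_le[OF inj sub] by simp
qed

lemma clique_number_finite_if_colorable:
  assumes "proper_coloring G k f"
  shows "clique_number G < \<infinity>"
proof -
  have "clique_number G \<le> enat k"
    unfolding clique_number_def
    using proper_coloring_clique_card[OF assms] by (intro Sup_least) auto
  then show ?thesis
    using le_less_trans enat_ord_code(4) by blast
qed

lemma finite_clique_if_clique_number_finite:
  assumes "clique_number G < \<infinity>" "is_clique G C"
  shows "finite C"
proof (rule ccontr)
  assume "infinite C"
  then have "\<infinity> \<le> clique_number G"
    unfolding clique_number_def using assms(2) by (intro Sup_upper) force
  then show False using assms(1) by simp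
qed

section \<open>Uniform elements modulo a radical ideal\<close>

text \<open>Closure under square roots suffices: iterating it handles all powers, so
  \<open>A\<close> is radical in the usual sense.\<close>

locale radical_ideal = ideal A R + cring R for A and R (structure) +
  assumes radical: "\<lbrakk>x \<in> carrier R; x \<otimes> x \<in> A\<rbrakk> \<Longrightarrow> x \<in> A"
begin

text \<open>Representatives of nonzero, pairwise orthogonal elements of \<open>R/A\<close>. Distinct
  members lie in distinct cosets, since congruent ones would have their squares in
  \<open>A\<close>.\<close>

definition orthogonal_set :: "'a set \<Rightarrow> bool"
  where "orthogonal_set S \<longleftrightarrow> S \<subseteq> carrier R - A \<and> (\<forall>x\<in>S. \<forall>y\<in>S. x \<noteq> y \<longrightarrow> x \<otimes> y \<in> A)"

text \<open>Primeness of \<open>(A : u)\<close>, stated as multiplicative closure of its complement;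
  \<open>u \<notin> A\<close> makes the ideal proper.\<close>

definition uniform :: "'a \<Rightarrow> bool"
  where "uniform u \<longleftrightarrow> u \<in> carrier R - A \<and>
    (\<forall>x\<in>carrier R. \<forall>y\<in>carrier R. x \<otimes> u \<notin> A \<longrightarrow> y \<otimes> u \<notin> A \<longrightarrow> x \<otimes> y \<otimes> u \<notin> A)"

lemma infinite_orthogonal_set_if_no_uniform_multiple:
  assumes x: "x \<in> carrier R - A"
    and none: "\<And>r. r \<in> carrier R \<Longrightarrow> \<not> uniform (r \<otimes> x)"
  shows "\<exists>S. orthogonal_set S \<and> infinite S"
proof -
  \<comment> \<open>The invariant of the iteration; it passes to every multiple that stays outside
    \<open>A\<close>.\<close>
  define B where "B = {w \<in> carrier R - A. \<forall>r\<in>carrier R. \<not> uniform (r \<otimes> w)}"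
  \<comment> \<open>Here \<open>v\<close> is the piece set aside and \<open>w'\<close> the remainder
    that is split again; both are multiples of \<open>w\<close>.\<close>
  define splits where
    "splits w v w' \<longleftrightarrow> (\<exists>a\<in>carrier R. \<exists>b\<in>carrier R. v = a \<otimes> w \<and> w' = b \<otimes> w) \<and> v \<notin> A \<and> v \<otimes> w' \<in> A"
    for w v w'
  have "\<exists>w'. w' \<in> B \<and> (\<exists>v. splits w v w')" if "w \<in> B" for w
  proof -
    have w: "w \<in> carrier R" "w \<notin> A" and nw: "\<And>r. r \<in> carrier R \<Longrightarrow> \<not> uniform (r \<otimes> w)"
      using that unfolding B_def by auto
    have "\<not> uniform w" using nw[of \<one>] w by simp
    then obtain a b where ab: "a \<in> carrier R" "b \<in> carrier R" "a \<otimes> w \<notin> A" "b \<otimes> w \<notin> A"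
        "a \<otimes> b \<otimes> w \<in> A"
      using w unfolding uniform_def by blast
    have "(a \<otimes> w) \<otimes> (b \<otimes> w) = w \<otimes> (a \<otimes> b \<otimes> w)"
      using ab w by (simp add: m_ac)
    then have "splits w (a \<otimes> w) (b \<otimes> w)"
      using ab w I_l_closed unfolding splits_def by auto
    moreover have "b \<otimes> w \<in> B"
      using ab w nw unfolding B_def by (auto simp flip: m_assoc)
    ultimately show ?thesis by blast
  qed
  moreover have "x \<in> B" using x none unfolding B_def by simp
  ultimately obtain w where w: "\<And>n::nat. w n \<in> B" and "\<And>n. \<exists>v. splits (w n) v (w (Suc n))"
    using dependent_nat_choice[of "\<lambda>_ w. w \<in> B" "\<lambda>_ w w'. \<exists>v. splits w v w'"] by blast
  then obtain v where v: "\<And>n. splits (w n) (v n) (w (Suc n))" by metis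
  have wc: "w n \<in> carrier R" for n using w unfolding B_def by blast
  have vc: "v n \<in> carrier R" "v n \<notin> A" for n
    using v[of n] wc[of n] unfolding splits_def by auto
  \<comment> \<open>Each remainder is a multiple of all earlier ones, which carries orthogonality
    from consecutive stages to arbitrary ones.\<close>
  have mult: "\<exists>r\<in>carrier R. w (n + k) = r \<otimes> w n" for n k
  proof (induction k)
    case 0
    show ?case using wc[of n] by (auto intro!: bexI[of _ \<one>])
  next
    case (Suc k)
    then obtain r where r: "r \<in> carrier R" "w (n + k) = r \<otimes> w n" by blast
    obtain b where b: "b \<in> carrier R" "w (Suc (n + k)) = b \<otimes> w (n + k)"
      using v[of "n + k"] unfolding splits_def by blast
    then have "w (n + Suc k) = (b \<otimes> r) \<otimes> w n"
      using r wc[of n] by (simp add: m_assoc)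
    then show ?case using b r by blast
  qed
  \<comment> \<open>The later piece \<open>v m\<close> is a multiple of \<open>w m\<close>, hence of
    \<open>w (Suc n)\<close>, to which \<open>v n\<close> is orthogonal.\<close>
  have less: "v n \<otimes> v m \<in> A" if "n < m" for n m
  proof -
    obtain k where "m = Suc n + k" using \<open>n < m\<close> less_iff_Suc_add by auto
    then obtain r where r: "r \<in> carrier R" "w m = r \<otimes> w (Suc n)" using mult by blast
    obtain a where a: "a \<in> carrier R" "v m = a \<otimes> w m" using v[of m] unfolding splits_def by blast
    have "v n \<otimes> v m = (a \<otimes> r) \<otimes> (v n \<otimes> w (Suc n))"
      using a r vc wc by (simp add: m_ac)
    then show ?thesis
      using v[of n] a r I_l_closed unfolding splits_def by auto
  qed
  have ne: "v n \<otimes> v m \<in> A" if "n \<noteq> m" for n m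
    using less[of n m] less[of m n] that m_comm[OF vc(1)[of n] vc(1)[of m]]
    by (cases "n < m") auto
  \<comment> \<open>A repeated piece would be orthogonal to itself, which radicality
    forbids.\<close>
  have "inj v"
  proof (rule injI, rule ccontr)
    fix n m assume "v n = v m" "n \<noteq> m"
    then have "v n \<otimes> v n \<in> A" using ne[of n m] by simp
    then show False using radical vc by blast
  qed
  then have "infinite (range v)" by (simp add: finite_image_iff)
  moreover have "orthogonal_set (range v)"
    unfolding orthogonal_set_def using vc by (auto intro!: ne)
  ultimately show ?thesis by blast
qed

text \<open>Take a maximal orthogonal set \<open>U\<close> of uniform elements. An \<open>x\<close>
  outside \<open>A\<close> orthogonal to all of \<open>U\<close> would have a uniform multiple that
  could be adjoined to \<open>U\<close>.\<close>

lemma finite_separating_uniform_set: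
  assumes fin: "\<And>S. orthogonal_set S \<Longrightarrow> finite S"
  obtains U where "finite U" "\<And>u. u \<in> U \<Longrightarrow> uniform u"
    "\<And>x. x \<in> carrier R - A \<Longrightarrow> \<exists>u\<in>U. x \<otimes> u \<notin> A"
proof -
  \<comment> \<open>In this auxiliary graph the cliques are the maximal orthogonal sets of uniform
    elements, so the Zorn argument for graphs can be reused. Loops do no harm, as completeness tests
    only distinct pairs.\<close>
  define G where "G = \<lparr>verts = Collect uniform, adj = \<lambda>x y. x \<otimes> y \<in> A\<rparr>"
  obtain U where U: "is_clique G U"
    using complete_in_extends_to_clique[of G "{}"] unfolding complete_in_def by auto
  then have unif: "\<And>u. u \<in> U \<Longrightarrow> uniform u"
    and orth: "\<And>u u'. u \<in> U \<Longrightarrow> u' \<in> U \<Longrightarrow> u \<noteq> u' \<Longrightarrow> u \<otimes> u' \<in> A"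
    unfolding is_clique_def complete_in_def G_def by auto
  show thesis
  proof (rule that)
    have "U \<subseteq> carrier R - A"
      using unif unfolding uniform_def by blast
    then show "finite U"
      using orth by (intro fin) (simp add: orthogonal_set_def)
    show "uniform u" if "u \<in> U" for u using that by (rule unif)
    show "\<exists>u\<in>U. x \<otimes> u \<notin> A" if x: "x \<in> carrier R - A" for x
    proof (rule ccontr)
      assume "\<not> (\<exists>u\<in>U. x \<otimes> u \<notin> A)"
      then have xU: "x \<otimes> u \<in> A" if "u \<in> U" for u using that by blast
      obtain r where r: "r \<in> carrier R" "uniform (r \<otimes> x)"
        using infinite_orthogonal_set_if_no_uniform_multiple[OF x] fin by blast
      let ?y = "r \<otimes> x"
      have yU: "?y \<otimes> u \<in> A" "u \<otimes> ?y \<in> A" if "u \<in> U" for u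
      proof -
        have "u \<in> carrier R" using unif[OF that] unfolding uniform_def by blast
        then show "?y \<otimes> u \<in> A"
          using x r I_l_closed[OF xU[OF that] r(1)] by (simp add: m_assoc)
        then show "u \<otimes> ?y \<in> A"
          using \<open>u \<in> carrier R\<close> x r by (simp add: m_comm)
      qed
      have "complete_in G (insert ?y U)"
        using unif orth yU r(2) unfolding complete_in_def G_def by auto
      \<comment> \<open>Maximality puts \<open>?y\<close> into \<open>U\<close>, so it is orthogonal
        to itself, against radicality.\<close>
      then have "?y \<in> U"
        using U unfolding is_clique_def by blast
      then have "?y \<otimes> ?y \<in> A" using yU by blast
      then show False
        using radical r(2) unfolding uniform_def by blast
    qed
  qed
qed

end

section \<open>Annihilating submodules\<close>

context Module.module
begin

section \<open>Colon ideals and the vanishing of products\<close>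

lemma zero_in_submodule:
  assumes "submodule N R M"
  shows "\<zero>\<^bsub>M\<^esub> \<in> N"
  using submoduleE(1,2,4)[OF assms] by (metis R.zero_closed ex_in_conv smult_l_null subsetD)

lemma ideal_colon:
  assumes "submodule N R M"
  shows "ideal (colon R M N) R"
proof (intro idealI subgroup.intro)
  note N = submoduleE[OF assms]
  show "ring R" by (rule R.ring_axioms)
  show "colon R M N \<subseteq> carrier (add_monoid R)" unfolding colon_def by auto
  show "x \<otimes>\<^bsub>add_monoid R\<^esub> y \<in> colon R M N" if "x \<in> colon R M N" "y \<in> colon R M N" for x y
    using that N unfolding colon_def by (auto simp: smult_l_distr)
  show "\<one>\<^bsub>add_monoid R\<^esub> \<in> colon R M N"
    using zero_in_submodule[OF assms] unfolding colon_def by auto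
  show "inv\<^bsub>add_monoid R\<^esub> x \<in> colon R M N" if "x \<in> colon R M N" for x
    using that N unfolding colon_def by (auto simp: smult_l_minus simp flip: a_inv_def)
  show left: "x \<otimes> a \<in> colon R M N" if "a \<in> colon R M N" "x \<in> carrier R" for a x
    using that N unfolding colon_def by (auto simp: smult_assoc1)
  show "a \<otimes> x \<in> colon R M N" if "a \<in> colon R M N" "x \<in> carrier R" for a x
    using left[OF that] that R.m_comm unfolding colon_def by auto
qed

lemma submodule_zero: "submodule {\<zero>\<^bsub>M\<^esub>} R M"
  by (rule submoduleI) auto

lemma ideal_Ann: "ideal (Ann R M) R"
  unfolding Ann_def by (rule ideal_colon[OF submodule_zero])

lemma Ann_subset_colon:
  assumes "submodule N R M"
  shows "Ann R M \<subseteq> colon R M N"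
  using zero_in_submodule[OF assms] unfolding Ann_def colon_def by auto

lemma ideal_smult_subset_zero:
  assumes "I \<subseteq> Ann R M" "K \<subseteq> carrier M"
  shows "ideal_smult M I K \<subseteq> {\<zero>\<^bsub>M\<^esub>}"
proof
  fix z assume "z \<in> ideal_smult M I K"
  then show "z \<in> {\<zero>\<^bsub>M\<^esub>}"
    by induction (use assms in \<open>auto simp: Ann_def colon_def\<close>)
qed

lemma ideal_prod_subset_Ann:
  assumes "\<And>a b. a \<in> I \<Longrightarrow> b \<in> J \<Longrightarrow> a \<otimes> b \<in> Ann R M"
  shows "I \<cdot> J \<subseteq> Ann R M"
proof
  interpret A: ideal "Ann R M" R by (rule ideal_Ann)
  fix z assume "z \<in> I \<cdot> J"
  then show "z \<in> Ann R M"
    by induction (use assms in auto)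
qed

text \<open>The product is generated by the elements \<open>(a \<otimes> b) \<odot> x\<close>, and
  \<open>Ann R M\<close> is closed under sums. Adjacency thereby becomes a condition on ring
  elements.\<close>

lemma submodule_prod_eq_zero_iff:
  assumes "submodule N R M" "submodule K R M"
  shows "submodule_prod R M N K = {\<zero>\<^bsub>M\<^esub>} \<longleftrightarrow>
    (\<forall>a\<in>colon R M N. \<forall>b\<in>colon R M K. a \<otimes> b \<in> Ann R M)" (is "?L \<longleftrightarrow> ?R")
proof
  assume L: ?L
  show ?R
  proof (intro ballI)
    fix a b assume ab: "a \<in> colon R M N" "b \<in> colon R M K"
    then have "(a \<otimes> b) \<odot>\<^bsub>M\<^esub> x \<in> submodule_prod R M N K" if "x \<in> carrier M" for x
      using that unfolding submodule_prod_def by (intro ideal_smult.smult ideal_prod.prod)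
    moreover have "a \<in> carrier R" "b \<in> carrier R" using ab unfolding colon_def by auto
    ultimately show "a \<otimes> b \<in> Ann R M"
      using L unfolding Ann_def colon_def by auto
  qed
next
  assume R: ?R
  interpret N: ideal "colon R M N" R by (rule ideal_colon[OF assms(1)])
  interpret K: ideal "colon R M K" R by (rule ideal_colon[OF assms(2)])
  \<comment> \<open>The inductive sets have no rule for the empty sum, so zero is exhibited as a
    generator.\<close>
  have "(\<zero> \<otimes> \<zero>) \<odot>\<^bsub>M\<^esub> \<zero>\<^bsub>M\<^esub> \<in> submodule_prod R M N K"
    unfolding submodule_prod_def
    by (intro ideal_smult.smult ideal_prod.prod N.zero_closed K.zero_closed M.zero_closed)
  then have "\<zero>\<^bsub>M\<^esub> \<in> submodule_prod R M N K" by simp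
  moreover have "submodule_prod R M N K \<subseteq> {\<zero>\<^bsub>M\<^esub>}"
    unfolding submodule_prod_def using R
    by (intro ideal_smult_subset_zero ideal_prod_subset_Ann) auto
  ultimately show ?L by blast
qed

text \<open>Apply semiprimeness to \<open>I = Rx\<close> and \<open>K = M\<close>: if
  \<open>x \<otimes> x\<close> kills \<open>M\<close>, then so does \<open>I\<close> squared, hence
  \<open>I\<close>, which contains \<open>x\<close>.\<close>

lemma semiprime_radical_ideal_Ann:
  assumes "semiprime_module R M"
  shows "radical_ideal (Ann R M) R"
proof -
  interpret A: ideal "Ann R M" R by (rule ideal_Ann)
  have "x \<in> Ann R M" if x: "x \<in> carrier R" "x \<otimes> x \<in> Ann R M" for x
  proof -
    have "a \<otimes> b \<in> Ann R M" if ab: "a \<in> PIdl x" "b \<in> PIdl x" for a b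
    proof -
      obtain r s where "r \<in> carrier R" "s \<in> carrier R" "a = r \<otimes> x" "b = s \<otimes> x"
        using ab unfolding cgenideal_def by blast
      then have "a \<otimes> b = (r \<otimes> s) \<otimes> (x \<otimes> x)" using x by (simp add: R.m_ac)
      then show ?thesis
        using x A.I_l_closed \<open>r \<in> carrier R\<close> \<open>s \<in> carrier R\<close> by simp
    qed
    then have "ideal_smult M ((PIdl x) \<cdot> (PIdl x)) (carrier M) \<subseteq> {\<zero>\<^bsub>M\<^esub>}"
      by (intro ideal_smult_subset_zero ideal_prod_subset_Ann) auto
    then have "ideal_smult M (PIdl x) (carrier M) \<subseteq> {\<zero>\<^bsub>M\<^esub>}"
      using assms R.cgenideal_ideal[OF x(1)] carrier_is_submodule
      unfolding semiprime_module_def semiprime_submodule_def by blast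
    then show ?thesis
      using x(1) R.cgenideal_self[OF x(1)] ideal_smult.smult[of x "PIdl x" _ "carrier M" M]
      unfolding Ann_def colon_def by auto
  qed
  then show ?thesis
    by (intro radical_ideal.intro radical_ideal_axioms.intro ideal_Ann R.is_cring)
qed

section \<open>The submodules \<open>rM\<close> as vertices of the graph\<close>

definition smult_image :: "'a \<Rightarrow> 'c set"
  where "smult_image r = (\<lambda>m. r \<odot>\<^bsub>M\<^esub> m) ` carrier M"

lemma submodule_smult_image:
  assumes r: "r \<in> carrier R"
  shows "submodule (smult_image r) R M"
proof (rule submoduleI)
  show "smult_image r \<subseteq> carrier M"
    using r unfolding smult_image_def by auto
  show "\<zero>\<^bsub>M\<^esub> \<in> smult_image r"
    using r unfolding smult_image_def by (auto intro!: image_eqI[of _ _ "\<zero>\<^bsub>M\<^esub>"])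
  show "\<ominus>\<^bsub>M\<^esub> a \<in> smult_image r" if "a \<in> smult_image r" for a
    using that r unfolding smult_image_def by (auto simp flip: smult_r_minus)
  show "a \<oplus>\<^bsub>M\<^esub> b \<in> smult_image r" if "a \<in> smult_image r" "b \<in> smult_image r" for a b
    using that r unfolding smult_image_def by (auto simp flip: smult_r_distr)
  show "s \<odot>\<^bsub>M\<^esub> a \<in> smult_image r" if s: "s \<in> carrier R" and a: "a \<in> smult_image r" for s a
  proof -
    obtain m where m: "m \<in> carrier M" "a = r \<odot>\<^bsub>M\<^esub> m"
      using a unfolding smult_image_def by blast
    then have "s \<odot>\<^bsub>M\<^esub> a = r \<odot>\<^bsub>M\<^esub> (s \<odot>\<^bsub>M\<^esub> m)"
      using r s by (simp add: R.m_comm flip: smult_assoc1)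
    then show ?thesis using m s unfolding smult_image_def by blast
  qed
qed

lemma colon_smult_image_self:
  "r \<in> carrier R \<Longrightarrow> r \<in> colon R M (smult_image r)"
  unfolding colon_def smult_image_def by simp

lemma smult_smult_image_eq_zero:
  assumes "r \<in> carrier R" "s \<in> carrier R" "r \<otimes> s \<in> Ann R M" "n \<in> smult_image r"
  shows "s \<odot>\<^bsub>M\<^esub> n = \<zero>\<^bsub>M\<^esub>"
  using assms R.m_comm[of r s] unfolding smult_image_def Ann_def colon_def
  by (auto simp flip: smult_assoc1)

text \<open>For \<open>a\<close> in \<open>(rM : M)\<close> and \<open>b\<close> in
  \<open>(sM : M)\<close>, commutativity gives
  \<open>abM \<subseteq> a(sM) = s(aM) \<subseteq> s(rM) = 0\<close>.\<close>

lemma smult_image_prod_eq_zero: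
  assumes r: "r \<in> carrier R" and s: "s \<in> carrier R" and rs: "r \<otimes> s \<in> Ann R M"
  shows "submodule_prod R M (smult_image r) (smult_image s) = {\<zero>\<^bsub>M\<^esub>}"
proof -
  have "a \<otimes> b \<in> Ann R M" if ab: "a \<in> colon R M (smult_image r)" "b \<in> colon R M (smult_image s)" for a b
  proof -
    have abc: "a \<in> carrier R" "b \<in> carrier R"
      and ai: "\<And>m. m \<in> carrier M \<Longrightarrow> a \<odot>\<^bsub>M\<^esub> m \<in> smult_image r"
      and bi: "\<And>m. m \<in> carrier M \<Longrightarrow> b \<odot>\<^bsub>M\<^esub> m \<in> smult_image s"
      using ab unfolding colon_def by auto
    have "(a \<otimes> b) \<odot>\<^bsub>M\<^esub> m = \<zero>\<^bsub>M\<^esub>" if m: "m \<in> carrier M" for m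
    proof -
      obtain n where n: "n \<in> carrier M" "b \<odot>\<^bsub>M\<^esub> m = s \<odot>\<^bsub>M\<^esub> n"
        using bi[OF m] unfolding smult_image_def by blast
      have "(a \<otimes> b) \<odot>\<^bsub>M\<^esub> m = a \<odot>\<^bsub>M\<^esub> (s \<odot>\<^bsub>M\<^esub> n)"
        using abc m n by (simp add: smult_assoc1)
      also have "\<dots> = s \<odot>\<^bsub>M\<^esub> (a \<odot>\<^bsub>M\<^esub> n)"
        using abc s n by (simp add: R.m_comm flip: smult_assoc1)
      also have "\<dots> = \<zero>\<^bsub>M\<^esub>"
        using smult_smult_image_eq_zero[OF r s rs ai[OF n(1)]] .
      finally show ?thesis .
    qed
    then show ?thesis using abc unfolding Ann_def colon_def by auto
  qed
  then show ?thesis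
    using submodule_prod_eq_zero_iff[OF submodule_smult_image[OF r] submodule_smult_image[OF s]]
    by blast
qed

text \<open>If \<open>rM = M\<close>, then \<open>sM = s(rM) = 0\<close>, contrary to
  \<open>s \<notin> Ann R M\<close>.\<close>

lemma proper_submodule_smult_image:
  assumes r: "r \<in> carrier R" and s: "s \<in> carrier R - Ann R M" and rs: "r \<otimes> s \<in> Ann R M"
  shows "proper_submodule (smult_image r) R M"
proof -
  have "smult_image r \<noteq> carrier M"
    using smult_smult_image_eq_zero[OF r _ rs] s unfolding Ann_def colon_def by auto
  then show ?thesis
    using submodule_smult_image[OF r] unfolding proper_submodule_def by blast
qed

text \<open>The required partner is \<open>sM\<close>; the elements \<open>r\<close> and
  \<open>s\<close> themselves show that the two colon ideals exceed the annihilator.\<close>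

lemma smult_image_vertex:
  assumes r: "r \<in> carrier R - Ann R M" and s: "s \<in> carrier R - Ann R M"
    and rs: "r \<otimes> s \<in> Ann R M"
  shows "smult_image r \<in> verts (AG_star R M)"
proof -
  have sr: "s \<otimes> r \<in> Ann R M" using rs r s R.m_comm by auto
  have colon: "colon R M (smult_image r) \<noteq> Ann R M" "colon R M (smult_image s) \<noteq> Ann R M"
    using colon_smult_image_self r s by auto
  have "proper_submodule (smult_image r) R M" "proper_submodule (smult_image s) R M"
    using proper_submodule_smult_image r s rs sr by auto
  with colon show ?thesis
    using smult_image_prod_eq_zero[of r s] r s rs unfolding AG_star_def by auto
qed

section \<open>Passing between cliques of the graph and orthogonal sets of the ring\<close>

lemma finite_orthogonal_set:
  assumes "radical_ideal (Ann R M) R"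
    and fin: "\<And>C. is_clique (AG_star R M) C \<Longrightarrow> finite C"
    and S: "radical_ideal.orthogonal_set (Ann R M) R S"
  shows "finite S"
proof (cases "\<exists>r\<in>S. S \<subseteq> {r}")
  \<comment> \<open>An element needs a distinct orthogonal partner for \<open>rM\<close> to be shown
    a vertex, so singletons are treated apart. The empty set falls under the other case, where the
    claims about members are vacuous.\<close>
  case True
  then show ?thesis using finite_subset by blast
next
  case False
  interpret A: radical_ideal "Ann R M" R by fact
  have Sc: "S \<subseteq> carrier R - Ann R M"
    and orth: "\<And>r s. r \<in> S \<Longrightarrow> s \<in> S \<Longrightarrow> r \<noteq> s \<Longrightarrow> r \<otimes> s \<in> Ann R M"
    using S unfolding A.orthogonal_set_def by auto
  \<comment> \<open>If \<open>rM = sM\<close> with \<open>r \<noteq> s\<close>, then the product of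
    \<open>rM\<close> with itself vanishes; as \<open>r\<close> lies in \<open>(rM : M)\<close>, its
    square is in the annihilator.\<close>
  have inj: "inj_on smult_image S"
  proof (rule inj_onI, rule ccontr)
    fix r s assume rs: "r \<in> S" "s \<in> S" "smult_image r = smult_image s" "r \<noteq> s"
    then have rc: "r \<in> carrier R" "s \<in> carrier R" "r \<notin> Ann R M" using Sc by auto
    have "submodule_prod R M (smult_image r) (smult_image r) = {\<zero>\<^bsub>M\<^esub>}"
      using smult_image_prod_eq_zero[OF rc(1,2) orth] rs by simp
    then have "r \<otimes> r \<in> Ann R M"
      using submodule_prod_eq_zero_iff submodule_smult_image colon_smult_image_self rc(1) by blast
    then show False using A.radical rc by blast
  qed
  have "smult_image r \<in> verts (AG_star R M)" if "r \<in> S" for r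
  proof -
    obtain s where "s \<in> S" "r \<noteq> s" using False \<open>r \<in> S\<close> by blast
    then show ?thesis using smult_image_vertex[of r s] orth Sc \<open>r \<in> S\<close> by blast
  qed
  moreover have "submodule_prod R M (smult_image r) (smult_image s) = {\<zero>\<^bsub>M\<^esub>}"
    if "r \<in> S" "s \<in> S" "r \<noteq> s" for r s
    using that smult_image_prod_eq_zero orth Sc by blast
  ultimately have "complete_in (AG_star R M) (smult_image ` S)"
    unfolding complete_in_def AG_star_def by fastforce
  then obtain C where "is_clique (AG_star R M) C" "smult_image ` S \<subseteq> C"
    by (rule complete_in_extends_to_clique)
  then have "finite (smult_image ` S)"
    using fin finite_subset by blast
  then show ?thesis using inj finite_imageD by blast
qed

lemma proper_coloring_AG_star:
  assumes "radical_ideal (Ann R M) R"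
    and fin: "\<And>C. is_clique (AG_star R M) C \<Longrightarrow> finite C"
  shows "\<exists>k f. proper_coloring (AG_star R M) k f"
proof -
  interpret A: radical_ideal "Ann R M" R by fact
  obtain U where U: "finite U" "\<And>u. u \<in> U \<Longrightarrow> A.uniform u"
    "\<And>x. x \<in> carrier R - Ann R M \<Longrightarrow> \<exists>u\<in>U. x \<otimes> u \<notin> Ann R M"
    using A.finite_separating_uniform_set finite_orthogonal_set[OF assms] by blast
  \<comment> \<open>Colours must be natural numbers below a bound, so the members of
    \<open>U\<close> are numbered.\<close>
  obtain idx :: "'a \<Rightarrow> nat" where idx: "bij_betw idx U {..<card U}"
    using ex_bij_betw_finite_nat[OF U(1)] by (auto simp: lessThan_atLeast0)
  \<comment> \<open>The colon ideal of a vertex strictly contains the annihilator; any element of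
    the difference is separated from it by some \<open>u \<in> U\<close>.\<close>
  have "\<exists>u a. u \<in> U \<and> a \<in> colon R M N \<and> a \<otimes> u \<notin> Ann R M" if N: "N \<in> verts (AG_star R M)" for N
  proof -
    have "submodule N R M" "colon R M N \<noteq> Ann R M"
      using N unfolding AG_star_def proper_submodule_def by auto
    then obtain a where "a \<in> colon R M N" "a \<notin> Ann R M"
      using Ann_subset_colon by blast
    moreover from this have "a \<in> carrier R" unfolding colon_def by blast
    ultimately show ?thesis using U(3) by blast
  qed
  then obtain c a where c: "\<And>N. N \<in> verts (AG_star R M) \<Longrightarrow> c N \<in> U"
    and a: "\<And>N. N \<in> verts (AG_star R M) \<Longrightarrow> a N \<in> colon R M N"
    and ac: "\<And>N. N \<in> verts (AG_star R M) \<Longrightarrow> a N \<otimes> c N \<notin> Ann R M"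
    by metis
  have "idx (c N) \<noteq> idx (c K)"
    if N: "N \<in> verts (AG_star R M)" and K: "K \<in> verts (AG_star R M)" and adj: "adj (AG_star R M) N K"
    for N K
  proof
    assume "idx (c N) = idx (c K)"
    then have eq: "c N = c K"
      using idx c[OF N] c[OF K] by (auto simp: bij_betw_def dest: inj_onD)
    have carr: "a N \<in> carrier R" "a K \<in> carrier R" "c N \<in> carrier R"
      using a[OF N] a[OF K] U(2)[OF c[OF N]] unfolding colon_def A.uniform_def by auto
    \<comment> \<open>Neither \<open>a N\<close> nor \<open>a K\<close> lies in the prime ideal
      \<open>(A : u)\<close> of the common colour \<open>u\<close>, so neither does their product,
      whereas adjacency puts that product into the annihilator.\<close>
    have "a N \<otimes> a K \<otimes> c N \<notin> Ann R M"
      using U(2)[OF c[OF N]] ac[OF N] ac[OF K] carr eq unfolding A.uniform_def by auto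
    moreover have "a N \<otimes> a K \<in> Ann R M"
      using N K adj a[OF N] a[OF K] submodule_prod_eq_zero_iff[of N K]
      unfolding AG_star_def proper_submodule_def by auto
    ultimately show False using A.I_r_closed carr(3) by blast
  qed
  moreover have "(\<lambda>N. idx (c N)) ` verts (AG_star R M) \<subseteq> {..<card U}"
    using idx c unfolding bij_betw_def by blast
  ultimately have "proper_coloring (AG_star R M) (card U) (\<lambda>N. idx (c N))"
    unfolding proper_coloring_def by blast
  then show ?thesis by blast
qed

end

theorem corollary3p8:
  fixes R :: "('a, 'c) ring_scheme" and M :: "('a, 'b, 'd) module_scheme"
  assumes "Module.module R M"
    and "\<one>\<^bsub>R\<^esub> \<noteq> \<zero>\<^bsub>R\<^esub>"
    and "semiprime_module R M"
  shows "(chromatic_number (AG_star R M) < \<infinity> \<longleftrightarrow> clique_number (AG_star R M) < \<infinity>) \<and>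
         (clique_number (AG_star R M) < \<infinity> \<longleftrightarrow>
            \<not> (\<exists>C. is_clique (AG_star R M) C \<and> infinite C))"
proof -
  interpret Module.module R M by fact
  let ?G = "AG_star R M"
  \<comment> \<open>The cycle (a) to (b) to (c) to (a). The last implication fails for general
    graphs and is where semiprimeness enters.\<close>
  have "clique_number ?G < \<infinity>" if "chromatic_number ?G < \<infinity>"
    using that clique_number_finite_if_colorable chromatic_number_finite_iff by blast
  moreover have "\<not> (\<exists>C. is_clique ?G C \<and> infinite C)" if "clique_number ?G < \<infinity>"
    using that finite_clique_if_clique_number_finite by blast
  moreover have "chromatic_number ?G < \<infinity>" if "\<not> (\<exists>C. is_clique ?G C \<and> infinite C)"
    using that proper_coloring_AG_star[OF semiprime_radical_ideal_Ann[OF assms(3)]]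
      chromatic_number_finite_iff by blast
  ultimately show ?thesis by blast
qed

end
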